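(* Let $q\ge 6$ be a prime power and let $\mathcal V$ be a ruled quintic surface in $\mathrm{PG}(6,q)$. Then: (1) no two generators of $\mathcal V$ lie in a common plane; (2) no three generators of $\mathcal V$ lie in a common $4$-space; (3) no four generators of $\mathcal V$ lie in a common $5$-space.
   Context: Construction: in $\mathrm{PG}(6,q)$ let $\alpha$ be a plane and $\Pi_3$ a $3$-space with $\alpha\cap\Pi_3=\emptyset$. Let $\mathcal C$ be a non-degenerate conic in $\alpha$ and $\mathcal N_3$ a twisted cubic in $\Pi_3$, parametrised as $\mathcal C=\{(1,\theta,\theta^2)\}$ and $\mathcal N_3=\{(1,\epsilon,\epsilon^2,\epsilon^3)\}$ ($\theta,\epsilon\in\mathbb F_q\cup\{\infty\}$) in coordinates of $\alpha$, resp. $\Pi_3$, and let $\phi\in\mathrm{PGL}(2,q)$ act on parameters, giving a bijection from $\mathcal C$ to $\mathcal N_3$. The ruled quintic surface $\mathcal V$ is the set of points on the $q+1$ lines (generators) joining each point of $\mathcal C$ to its image under $\phi$; $\mathcal C$ is its conic directrix. *)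

theory Defs
  imports "HOL-Analysis.Analysis"
begin

text \<open>
  Points and subspaces of the projective space of a vector space are represented by the underlying
  linear subspaces, so that incidence is inclusion and projective dimension is linear dimension
  minus one. In particular \<open>PG(6,q)\<close> is given by the linear subspaces of \<open>'a ^ 7\<close>, where \<open>'a\<close> is a
  field with \<open>q\<close> elements.
\<close>

definition pg_subspace :: "nat \<Rightarrow> ('a::field ^ 'n) set \<Rightarrow> bool" where
  "pg_subspace d W \<longleftrightarrow> vec.subspace W \<and> vec.dim W = d + 1"

abbreviation pg_point :: "('a::field ^ 'n) set \<Rightarrow> bool" where
  "pg_point \<equiv> pg_subspace 0"

definition pg_join :: "('a::field ^ 'n) set \<Rightarrow> ('a ^ 'n) set \<Rightarrow> ('a ^ 'n) set" where
  "pg_join U W = vec.span (U \<union> W)"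

text \<open>Homogeneous coordinates in a \<open>d\<close>-space \<open>W\<close>, given by a basis \<open>b 0, \<dots>, b d\<close> of \<open>W\<close>.\<close>

definition coord_frame :: "nat \<Rightarrow> (nat \<Rightarrow> 'a::field ^ 'n) \<Rightarrow> ('a ^ 'n) set \<Rightarrow> bool" where
  "coord_frame d b W \<longleftrightarrow>
     inj_on b {..d} \<and> vec.independent (b ` {..d}) \<and> vec.span (b ` {..d}) = W"

text \<open>
  Parameters in \<open>F\<^sub>q \<union> {\<infinity>}\<close> are modelled by \<open>'a option\<close>, with \<open>None\<close> for \<open>\<infinity>\<close>.
  The point with parameter \<open>t\<close> has coordinates \<open>(1, t, \<dots>, t\<^sup>d)\<close> in the frame \<open>b\<close>, and the
  point with parameter \<open>\<infinity>\<close> has coordinates \<open>(0, \<dots>, 0, 1)\<close>. For \<open>d = 2\<close> these are the points of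
  a non-degenerate conic, for \<open>d = 3\<close> those of a twisted cubic.
\<close>

definition nrc_point :: "nat \<Rightarrow> (nat \<Rightarrow> 'a::field ^ 'n) \<Rightarrow> 'a option \<Rightarrow> ('a ^ 'n) set" where
  "nrc_point d b p =
     vec.span {case p of Some t \<Rightarrow> (\<Sum>i\<le>d. t ^ i *s b i) | None \<Rightarrow> b d}"

definition moebius_map :: "'a::field \<Rightarrow> 'a \<Rightarrow> 'a \<Rightarrow> 'a \<Rightarrow> 'a option \<Rightarrow> 'a option" where
  "moebius_map a b c d p =
     (case p of
        Some t \<Rightarrow> (if c * t + d = 0 then None else Some ((a * t + b) / (c * t + d)))
      | None \<Rightarrow> (if c = 0 then None else Some (a / c)))"

definition PGL2 :: "('a::field option \<Rightarrow> 'a option) set" where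
  "PGL2 = {moebius_map a b c d | a b c d. a * d - b * c \<noteq> 0}"

text \<open>
  \<open>V\<close> is the point set of a ruled quintic surface and \<open>G\<close> is the set of its generators.
\<close>

definition ruled_quintic_surface :: "('a::field ^ 7) set set \<Rightarrow> ('a ^ 7) set set \<Rightarrow> bool" where
  "ruled_quintic_surface V G \<longleftrightarrow>
     (\<exists>\<alpha> \<Pi>\<^sub>3 a b \<phi>.
        pg_subspace 2 \<alpha> \<and> pg_subspace 3 \<Pi>\<^sub>3 \<and>
        (\<nexists>P. pg_point P \<and> P \<subseteq> \<alpha> \<and> P \<subseteq> \<Pi>\<^sub>3) \<and>
        coord_frame 2 a \<alpha> \<and> coord_frame 3 b \<Pi>\<^sub>3 \<and>
        \<phi> \<in> PGL2 \<and>
        G = range (\<lambda>\<theta>. pg_join (nrc_point 2 a \<theta>) (nrc_point 3 b (\<phi> \<theta>))) \<and>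
        V = {P. pg_point P \<and> (\<exists>g\<in>G. P \<subseteq> g)})"

end

theory Submission
  imports Defs
begin

text \<open>
  The plane \<open>\<alpha>\<close> and the solid \<open>\<Pi>\<^sub>3\<close> are complementary, so a subspace containing the generators with
  parameters in \<open>T\<close> has vector space dimension at least the rank of the corresponding points of the
  conic plus the rank of those of the twisted cubic. Any at most \<open>d + 1\<close> points of a normal rational
  curve of degree \<open>d\<close> are independent: the linear forms restricted to the curve are the
  polynomials of degree at most \<open>d\<close>, and products of linear factors separate each of the points from
  the others. Hence 2, 3, 4 generators have ranks at least 2 + 2, 3 + 3, 3 + 4.
\<close>

section \<open>Independence of points on a normal rational curve\<close>

definition nrc_vector :: "nat \<Rightarrow> (nat \<Rightarrow> 'a::field ^ 'n) \<Rightarrow> 'a option \<Rightarrow> 'a ^ 'n" where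
  "nrc_vector d b p = (case p of Some t \<Rightarrow> (\<Sum>i\<le>d. t ^ i *s b i) | None \<Rightarrow> b d)"

lemma nrc_point_eq_span: "nrc_point d b p = vec.span {nrc_vector d b p}"
  by (simp add: nrc_point_def nrc_vector_def)

text \<open>
  A polynomial of degree at most \<open>d\<close> is homogenised to degree \<open>d\<close>; its value at infinity is then its
  coefficient of index \<open>d\<close>.
\<close>

definition poly_at :: "nat \<Rightarrow> 'a::field poly \<Rightarrow> 'a option \<Rightarrow> 'a" where
  "poly_at d g p = (case p of Some t \<Rightarrow> poly g t | None \<Rightarrow> coeff g d)"

text \<open>Take the product \<open>h\<close> of the linear factors at the finite parameters other
  than \<open>p\<close>. Only the value at infinity needs care, and the bound on
  \<open>card P\<close> leaves room in the degree for it.\<close>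

lemma separating_poly_exists:
  fixes P :: "'a::field option set"
  assumes fin: "finite P" and card: "card P \<le> d + 1" and p: "p \<in> P"
  shows "\<exists>g. degree g \<le> d \<and> poly_at d g p \<noteq> 0 \<and> (\<forall>p'\<in>P - {p}. poly_at d g p' = 0)"
proof -
  define F where "F = {t. Some t \<in> P - {p}}"
  define h where "h = (\<Prod>t\<in>F. [:- t, 1:])"
  have SomeF: "Some ` F = P - {p} - {None}"
    by (auto simp: F_def image_iff)
  have finF: "finite F"
    using fin SomeF by (metis finite_Diff finite_imageD inj_Some)
  have cardF: "card F = card (P - {p} - {None})"
    by (metis SomeF card_image inj_Some)
  have cardP: "card (P - {p}) \<le> d"
    using card p fin by simp
  have degh: "degree h = card F"
    unfolding h_def by (subst degree_prod_sum_eq) auto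
  have lead: "lead_coeff h = 1"
    unfolding h_def by (subst lead_coeff_prod) simp
  have root: "poly h t = 0 \<longleftrightarrow> t \<in> F" for t
    using finF by (auto simp: h_def poly_prod prod_zero_iff)
  show ?thesis
  proof (cases p)
    case None
    \<comment> \<open>The power of the variable raises the degree to exactly \<open>d\<close>, so
      that the value at infinity is the leading coefficient 1; the zeros on \<open>F\<close>
      remain.\<close>
    define g where "g = monom 1 (d - card F) * h"
    have le: "card F \<le> d"
      using cardF cardP None by simp
    have "h \<noteq> 0"
      using lead by auto
    then have "degree g = d"
      using le degh by (simp add: g_def degree_mult_eq degree_monom_eq)
    moreover have "lead_coeff g = 1"
      by (simp only: g_def lead_coeff_mult lead) (simp add: degree_monom_eq)
    moreover have "poly_at d g p' = 0" if "p' \<in> P - {p}" for p'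
      using that None by (cases p') (auto simp: poly_at_def g_def root F_def)
    ultimately show ?thesis
      using None by (intro exI[of _ g]) (simp add: poly_at_def)
  next
    case (Some s)
    have "card F \<le> d"
      using cardF cardP fin by (metis card_Diff1_le order_trans)
    moreover have "poly_at d h p \<noteq> 0"
      using Some by (simp add: poly_at_def root F_def)
    moreover have "poly_at d h p' = 0" if "p' \<in> P - {p}" for p'
    proof (cases p')
      case None
      \<comment> \<open>Infinity is itself one of the at most \<open>d\<close> other parameters, so
        \<open>h\<close> has degree below \<open>d\<close> and vanishes there.\<close>
      then have "card F < card (P - {p})"
        unfolding cardF using that fin by (intro card_Diff1_less) auto
      then show ?thesis
        using None cardP degh by (simp add: poly_at_def coeff_eq_0)
    next
      case (Some t)
      then show ?thesis
        using that by (simp add: poly_at_def root F_def)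
    qed
    ultimately show ?thesis
      using degh by (intro exI[of _ h]) simp
  qed
qed

text \<open>Prescribing the coefficients of \<open>g\<close> on the frame and extending linearly
  gives a form whose value on a curve vector is the value of \<open>g\<close>. The fixed vector
  \<open>e\<close> turns scalar values into vectors, so the form becomes a linear map between
  coordinate spaces; for \<open>e\<close> nonzero its zeros are those of the form.\<close>

lemma poly_as_linear_map:
  assumes "coord_frame d b W" and "degree g \<le> d"
  shows "\<exists>f. Vector_Spaces.linear (*s) (*s) f \<and>
             (\<forall>p. f (nrc_vector d b p) = poly_at d g p *s e)"
proof -
  from assms have inj: "inj_on b {..d}" and ind: "vec.independent (b ` {..d})"
    by (auto simp: coord_frame_def)
  obtain f where lin: "Vector_Spaces.linear (*s) (*s) f"
    and f: "\<forall>x\<in>b ` {..d}. f x = coeff g (inv_into {..d} b x) *s e"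
    using vec.linear_independent_extend[OF ind,
        where f = "\<lambda>x. coeff g (inv_into {..d} b x) *s e"] by blast
  have fb: "f (b i) = coeff g i *s e" if "i \<le> d" for i
    using f that inj by simp
  have poly: "poly g t = (\<Sum>i\<le>d. t ^ i * coeff g i)" for t
  proof -
    have "poly g t = poly (\<Sum>i\<le>d. monom (coeff g i) i) t"
      using assms(2) by (simp add: poly_as_sum_of_monoms')
    then show ?thesis
      by (simp add: poly_sum poly_monom mult.commute)
  qed
  have "f (nrc_vector d b p) = poly_at d g p *s e" for p
  proof (cases p)
    case None
    then show ?thesis
      by (simp add: nrc_vector_def poly_at_def fb)
  next
    case (Some t)
    have "f (\<Sum>i\<le>d. t ^ i *s b i) = (\<Sum>i\<le>d. (t ^ i * coeff g i) *s e)"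
      by (simp add: vec.linear_sum[OF lin] vec.linear_scale[OF lin] fb)
    also have "\<dots> = poly g t *s e"
      by (simp add: poly vec.scale_sum_left)
    finally show ?thesis
      using Some by (simp add: nrc_vector_def poly_at_def)
  qed
  with lin show ?thesis
    by blast
qed

text \<open>The linear map of a separating polynomial kills the span of the other points but not the
  point at \<open>p\<close>.\<close>

lemma nrc_vector_notin_span:
  fixes b :: "nat \<Rightarrow> 'a::field ^ 'n"
  assumes frame: "coord_frame d b W" and "finite P" and "card P \<le> d + 1" and "p \<in> P"
  shows "nrc_vector d b p \<notin> vec.span (nrc_vector d b ` (P - {p}))"
proof
  assume mem: "nrc_vector d b p \<in> vec.span (nrc_vector d b ` (P - {p}))"
  obtain g where deg: "degree g \<le> d" and g: "poly_at d g p \<noteq> 0"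
    "\<forall>p'\<in>P - {p}. poly_at d g p' = 0"
    using separating_poly_exists[OF assms(2-4)] by blast
  obtain f where lin: "Vector_Spaces.linear (*s) (*s) f"
    and f: "\<And>p. f (nrc_vector d b p) = poly_at d g p *s (1 :: 'a ^ 'n)"
    using poly_as_linear_map[OF frame deg] by blast
  have "f (nrc_vector d b p) = 0"
    by (rule vec.linear_eq_0_on_span[OF lin _ mem]) (use f g(2) in force)
  then show False
    using f g(1) by simp
qed

lemma dim_span_nrc_vectors:
  assumes "coord_frame d b W" and "finite P" and "card P \<le> d + 1"
  shows "vec.dim (vec.span (nrc_vector d b ` P)) = card P"
proof -
  have notin: "nrc_vector d b p \<notin> vec.span (nrc_vector d b ` (P - {p}))" if "p \<in> P" for p
    using nrc_vector_notin_span[OF assms that] .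
  have inj: "inj_on (nrc_vector d b) P"
  proof (rule inj_onI, rule ccontr)
    fix p p' assume "p \<in> P" "p' \<in> P" "nrc_vector d b p = nrc_vector d b p'" "p \<noteq> p'"
    then show False
      using notin[of p] by (auto intro: vec.span_base)
  qed
  have "vec.independent (nrc_vector d b ` P)"
    unfolding vec.dependent_def
  proof clarify
    fix p assume "p \<in> P"
      and "nrc_vector d b p \<in> vec.span (nrc_vector d b ` P - {nrc_vector d b p})"
    moreover from \<open>p \<in> P\<close>
    have "nrc_vector d b ` P - {nrc_vector d b p} = nrc_vector d b ` (P - {p})"
      using inj by (auto simp: inj_on_def)
    ultimately show False
      using notin by simp
  qed
  then show ?thesis
    by (simp add: vec.dim_eq_card_independent card_image[OF inj])
qed

lemma nrc_vector_in_frame: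
  assumes "coord_frame d b W"
  shows "nrc_vector d b p \<in> W"
proof -
  have "b i \<in> W" if "i \<le> d" for i
    using assms that by (auto simp: coord_frame_def intro: vec.span_base)
  moreover have "vec.subspace W"
    using assms by (auto simp: coord_frame_def)
  ultimately show ?thesis
    by (auto simp: nrc_vector_def split: option.split
        intro!: vec.subspace_sum vec.subspace_scale)
qed

section \<open>Complementary subspaces and dimension\<close>

lemma subspace_Int_trivial:
  fixes U W :: "('a::field ^ 'n) set"
  assumes "vec.subspace U" "vec.subspace W"
    and no_point: "\<nexists>P. pg_point P \<and> P \<subseteq> U \<and> P \<subseteq> W"
  shows "U \<inter> W \<subseteq> {0}"
proof (rule ccontr)
  assume "\<not> U \<inter> W \<subseteq> {0}"
  then obtain x where x: "x \<in> U" "x \<in> W" "x \<noteq> 0"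
    by auto
  then have "pg_point (vec.span {x})"
    by (simp add: pg_subspace_def vec.dim_eq_card_independent)
  moreover have "vec.span {x} \<subseteq> U" "vec.span {x} \<subseteq> W"
    using x assms(1,2) by (simp_all add: vec.span_minimal)
  ultimately show False
    using no_point by blast
qed

lemma dim_ge_add_dim:
  fixes U W X :: "('a::field ^ 'n) set"
  assumes "vec.subspace U" "vec.subspace W" "vec.subspace X"
    and "U \<inter> W \<subseteq> {0}" and "U \<subseteq> X" "W \<subseteq> X"
  shows "vec.dim U + vec.dim W \<le> vec.dim X"
proof -
  have "vec.dim (U \<inter> W) = 0"
    using assms(4) by simp
  then have "vec.dim U + vec.dim W = vec.dim {x + y |x y. x \<in> U \<and> y \<in> W}"
    using vec.dim_sums_Int[OF assms(1,2)] by linarith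
  also have "\<dots> \<le> vec.dim X"
    using assms by (intro vec.dim_subset) (auto intro: vec.subspace_add)
  finally show ?thesis .
qed

section \<open>Injectivity of projectivities on the parameters\<close>

lemma inj_moebius_map:
  fixes a b c d :: "'a::field"
  assumes det: "a * d - b * c \<noteq> 0"
  shows "inj (moebius_map a b c d)"
proof (rule injI)
  fix p p' assume eq: "moebius_map a b c d p = moebius_map a b c d p'"
  have None_Some: False if "moebius_map a b c d None = moebius_map a b c d (Some t)" for t
    \<comment> \<open>Equal finite values \<open>a / c\<close> and
      \<open>(a * t + b) / (c * t + d)\<close> give \<open>a * d = b * c\<close> after clearing
      denominators.\<close>
    using that det
    by (auto simp: moebius_map_def frac_eq_eq algebra_simps split: if_splits)
  have Some_Some: "s = t"
    if "moebius_map a b c d (Some s) = moebius_map a b c d (Some t)" for s t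
  proof (cases "c * s + d = 0")
    case True
    then have "c * t + d = 0"
      using that by (auto simp: moebius_map_def split: if_splits)
    with True have "c * (s - t) = 0"
      by algebra
    \<comment> \<open>Both parameters are poles here; if \<open>c\<close> were 0, then
      \<open>d\<close> would be 0 too and the determinant would vanish.\<close>
    moreover have "c \<noteq> 0"
      using True det by auto
    ultimately show ?thesis
      by simp
  next
    case False
    then have "c * t + d \<noteq> 0"
      and "(a * s + b) / (c * s + d) = (a * t + b) / (c * t + d)"
      using that by (auto simp: moebius_map_def split: if_splits)
    with False have "(a * s + b) * (c * t + d) = (a * t + b) * (c * s + d)"
      by (simp add: frac_eq_eq)
    then have "(a * d - b * c) * (s - t) = 0"
      by algebra
    with det show ?thesis
      by simp
  qed
  show "p = p'"
    using eq None_Some Some_Some by (cases p; cases p') metis+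
qed

lemma inj_PGL2: "\<phi> \<in> PGL2 \<Longrightarrow> inj \<phi>"
  by (auto simp: PGL2_def inj_moebius_map)

section \<open>Subspaces containing given generators\<close>

lemma pg_join_nrc_points_subset_iff:
  assumes "vec.subspace X"
  shows "pg_join (nrc_point d a p) (nrc_point e b p') \<subseteq> X \<longleftrightarrow>
           nrc_vector d a p \<in> X \<and> nrc_vector e b p' \<in> X"
proof -
  have "pg_join (nrc_point d a p) (nrc_point e b p') =
          vec.span {nrc_vector d a p, nrc_vector e b p'}"
    unfolding pg_join_def nrc_point_eq_span vec.span_Un vec.span_span
    by (simp flip: vec.span_Un add: insert_commute)
  moreover have "vec.span S \<subseteq> X \<longleftrightarrow> S \<subseteq> X" for S
    using assms by (meson vec.span_minimal vec.span_superset order_trans)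
  ultimately show ?thesis
    by simp
qed

text \<open>The two summands are the ranks on the conic and on the twisted cubic. The conic spans
  only a plane, whence the cap at 3; on the cubic up to 4 points are independent.\<close>

lemma dim_ge_of_generators_subset:
  fixes V G :: "('a::field ^ 7) set set"
  assumes "ruled_quintic_surface V G"
    and S: "S \<subseteq> G" "finite S" "card S \<le> 4"
    and X: "vec.subspace X" "\<And>g. g \<in> S \<Longrightarrow> g \<subseteq> X"
  shows "min (card S) 3 + card S \<le> vec.dim X"
proof -
  obtain \<alpha> \<Pi>\<^sub>3 a b \<phi> where
    sub: "pg_subspace 2 \<alpha>" "pg_subspace 3 \<Pi>\<^sub>3"
    and disj: "\<nexists>P. pg_point P \<and> P \<subseteq> \<alpha> \<and> P \<subseteq> \<Pi>\<^sub>3"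
    and a: "coord_frame 2 a \<alpha>" and b: "coord_frame 3 b \<Pi>\<^sub>3" and \<phi>: "\<phi> \<in> PGL2"
    and G: "G = range (\<lambda>\<theta>. pg_join (nrc_point 2 a \<theta>) (nrc_point 3 b (\<phi> \<theta>)))"
    using assms(1) unfolding ruled_quintic_surface_def by blast
  let ?g = "\<lambda>\<theta>. pg_join (nrc_point 2 a \<theta>) (nrc_point 3 b (\<phi> \<theta>))"
  \<comment> \<open>Choosing one parameter for each generator in \<open>S\<close> gives
    \<open>card T = card S\<close> without first showing that distinct parameters yield distinct
    generators.\<close>
  obtain T where inj: "inj_on ?g T" and T: "S = ?g ` T"
    using S(1) unfolding G subset_image_inj by blast
  have finT: "finite T" and cardT: "card T = card S"
    using inj S(2) by (auto simp: T card_image dest: finite_imageD)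
  \<comment> \<open>Independence on the conic is available for at most 3 points, so a fourth
    parameter is dropped there.\<close>
  obtain T' where T': "T' \<subseteq> T" "card T' = min (card S) 3"
    using obtain_subset_with_card_n[of "min (card S) 3" T] cardT by auto
  have card\<phi>: "card (\<phi> ` T) = card S"
    using inj_PGL2[OF \<phi>] cardT by (metis card_image inj_on_subset subset_UNIV)
  define A where "A = vec.span (nrc_vector 2 a ` T')"
  define B where "B = vec.span (nrc_vector 3 b ` \<phi> ` T)"
  have sub': "vec.subspace \<alpha>" "vec.subspace \<Pi>\<^sub>3"
    using sub by (auto simp: pg_subspace_def)
  have "A \<subseteq> \<alpha>" "B \<subseteq> \<Pi>\<^sub>3"
    unfolding A_def B_def using sub' nrc_vector_in_frame[OF a] nrc_vector_in_frame[OF b]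
    by (meson image_subsetI vec.span_minimal)+
  then have "A \<inter> B \<subseteq> {0}"
    using subspace_Int_trivial[OF sub' disj] by blast
  moreover have "nrc_vector 2 a \<theta> \<in> X \<and> nrc_vector 3 b (\<phi> \<theta>) \<in> X" if "\<theta> \<in> T" for \<theta>
    using X(2)[of "?g \<theta>"] that pg_join_nrc_points_subset_iff[OF X(1)] T by blast
  then have "A \<subseteq> X" "B \<subseteq> X"
    unfolding A_def B_def using T'(1) by (intro vec.span_minimal X(1); blast)+
  ultimately have "vec.dim A + vec.dim B \<le> vec.dim X"
    using X(1) by (intro dim_ge_add_dim) (auto simp: A_def B_def)
  moreover have "vec.dim A = min (card S) 3"
    unfolding A_def using T' finite_subset[OF T'(1) finT] by (subst dim_span_nrc_vectors[OF a]) auto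
  moreover have "vec.dim B = card S"
    unfolding B_def using finT card\<phi> S(3) by (subst dim_span_nrc_vectors[OF b]) auto
  ultimately show ?thesis
    by simp
qed

theorem theorem2p2:
  fixes V G :: "('a::{field,finite} ^ 7) set set" and q :: nat
  assumes "q = CARD('a)" and "q \<ge> 6"
    and "ruled_quintic_surface V G"
  shows "(\<forall>S. S \<subseteq> G \<and> card S = 2 \<longrightarrow> \<not> (\<exists>W. pg_subspace 2 W \<and> (\<forall>g\<in>S. g \<subseteq> W)))
       \<and> (\<forall>S. S \<subseteq> G \<and> card S = 3 \<longrightarrow> \<not> (\<exists>W. pg_subspace 4 W \<and> (\<forall>g\<in>S. g \<subseteq> W)))
       \<and> (\<forall>S. S \<subseteq> G \<and> card S = 4 \<longrightarrow> \<not> (\<exists>W. pg_subspace 5 W \<and> (\<forall>g\<in>S. g \<subseteq> W)))"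
proof -
  \<comment> \<open>A projective \<open>n\<close>-space has vector dimension \<open>n + 1\<close>,
    so the comparisons are 3 < 4, 5 < 6 and 6 < 7. A nonzero \<open>card S\<close> ensures that
    \<open>S\<close> is finite.\<close>
  have no_space: "\<not> (\<exists>W. pg_subspace n W \<and> (\<forall>g\<in>S. g \<subseteq> W))"
    if "S \<subseteq> G" "card S \<noteq> 0" "card S \<le> 4" "n + 1 < min (card S) 3 + card S" for S n
    using dim_ge_of_generators_subset[OF assms(3) that(1) card_ge_0_finite that(3)] that(2,4)
    unfolding pg_subspace_def by (metis linorder_not_less neq0_conv)
  show ?thesis
    by (intro conjI allI impI; rule no_space) simp_all
qed

end
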